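(* Let $\sigma$ be a complex polynomial of degree $\le2$, $\kappa_0$ a complex polynomial of degree $\le1$, and $\omega_0\in\mathbb{C}$. For $n\in\mathbb{C}$ set $$\kappa_n(z):=n\sigma'(z)+\kappa_0(z),\qquad \omega_n:=n^2\frac{\sigma''}{2}+n\kappa_0'+\omega_0 .$$ Then for every $n\in\mathbb{C}$: (1) (Factorization) $$\begin{aligned}\mathcal{H}(\sigma,\kappa_n)+\omega_n&=\big(\sigma(z)\partial_z+\kappa_{n+1}(z)\big)\partial_z+n(n+1)\tfrac{\sigma''}{2}+(n+\tfrac12)\kappa_0'+\omega_0\\&=\partial_z\big(\sigma(z)\partial_z+\kappa_n(z)\big)+n(n-1)\tfrac{\sigma''}{2}+(n-\tfrac12)\kappa_0'+\omega_0.\end{aligned}$$ (2) (Transmutation) $$\partial_z\big(\mathcal{H}(\sigma,\kappa_n)+\omega_n\big)=\big(\mathcal{H}(\sigma,\kappa_{n+1})+\omega_{n+1}\big)\partial_z,$$ $$\big(\sigma(z)\partial_z+\kappa_{n+1}(z)\big)\big(\mathcal{H}(\sigma,\kappa_{n+1})+\omega_{n+1}\big)=\big(\mathcal{H}(\sigma,\kappa_n)+\omega_n\big)\big(\sigma(z)\partial_z+\kappa_{n+1}(z)\big).$$ (3) (Recurrence relations) $$\big(\mathcal{H}(\sigma,\kappa_n)+\omega_n\big)F=0\ \Rightarrow\ \big(\mathcal{H}(\sigma,\kappa_{n+1})+\omega_{n+1}\big)\partial_zF=0,$$ $$\big(\mathcal{H}(\sigma,\kappa_{n+1})+\omega_{n+1}\big)F=0\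 \Rightarrow\ \big(\mathcal{H}(\sigma,\kappa_n)+\omega_n\big)\big(\sigma(z)\partial_z+\kappa_{n+1}(z)\big)F=0 .$$
   Context: For polynomials $\sigma,\kappa$ with $\deg\sigma\le2$, $\deg\kappa\le1$, $$\mathcal{H}(\sigma,\kappa):=\sigma(z)\partial_z^2+\big(\sigma'(z)+\kappa(z)\big)\partial_z+\tfrac12\kappa'.$$ The identities are identities of differential operators acting on analytic functions of $z$; $F$ is an analytic function on some domain. $\sigma''$ and $\kappa_0'$ are constants. *)

theory Defs
  imports "HOL-Complex_Analysis.Complex_Analysis" "HOL-Computational_Algebra.Polynomial"
begin

text \<open>
  Differential operators are rendered as maps on total functions on the complex plane, with
  \<^term>\<open>deriv\<close> as the derivation and \<^term>\<open>(\<circ>)\<close> as the product of operators. A function that is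
  analytic only on a domain has arbitrary values elsewhere, so operators are compared only on that
  domain and only on functions analytic there (see \<open>op_eq_on\<close>); since \<^term>\<open>deriv f z\<close> depends only
  on \<^term>\<open>f\<close> near \<^term>\<open>z\<close>, the outside values play no role.
\<close>

type_synonym dop = "(complex \<Rightarrow> complex) \<Rightarrow> (complex \<Rightarrow> complex)"

definition mult_op :: "complex poly \<Rightarrow> dop" where
  "mult_op p f = (\<lambda>z. poly p z * f z)"

definition scalar_op :: "complex \<Rightarrow> dop" where
  "scalar_op c f = (\<lambda>z. c * f z)"

text \<open>The priority is chosen so that \<^term>\<open>(\<circ>)\<close> binds more tightly than the sum of operators.\<close>

definition add_op :: "dop \<Rightarrow> dop \<Rightarrow> dop" (infixl "\<boxplus>" 52) where
  "(A \<boxplus> B) f = (\<lambda>z. A f z + B f z)"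

definition is_domain :: "complex set \<Rightarrow> bool" where
  "is_domain U \<longleftrightarrow> open U \<and> connected U \<and> U \<noteq> {}"

definition op_eq_on :: "complex set \<Rightarrow> dop \<Rightarrow> dop \<Rightarrow> bool" where
  "op_eq_on U A B \<longleftrightarrow> (\<forall>f. f analytic_on U \<longrightarrow> (\<forall>z\<in>U. A f z = B f z))"

definition Hop :: "complex poly \<Rightarrow> complex poly \<Rightarrow> dop" where
  "Hop \<sigma> \<kappa> =
     mult_op \<sigma> \<circ> deriv \<circ> deriv \<boxplus> mult_op (pderiv \<sigma> + \<kappa>) \<circ> deriv \<boxplus> mult_op (smult (1/2) (pderiv \<kappa>))"

text \<open>
  For \<open>deg \<sigma> \<le> 2\<close> and \<open>deg \<kappa> \<le> 1\<close> the polynomials \<open>\<sigma>''\<close> and \<open>\<kappa>'\<close> are constant; the following are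
  these constants as complex numbers.
\<close>

definition const_d1 :: "complex poly \<Rightarrow> complex" where
  "const_d1 \<kappa> = poly (pderiv \<kappa>) 0"

definition const_d2 :: "complex poly \<Rightarrow> complex" where
  "const_d2 \<sigma> = poly (pderiv (pderiv \<sigma>)) 0"

lemma pderiv_eq_const_d1:
  assumes "degree \<kappa> \<le> 1"
  shows "pderiv \<kappa> = [:const_d1 \<kappa>:]"
proof -
  have "degree (pderiv \<kappa>) = 0"
    using assms by (simp add: degree_pderiv)
  then obtain c where "pderiv \<kappa> = [:c:]"
    by (rule degree_eq_zeroE)
  then show ?thesis by (simp add: const_d1_def)
qed

lemma pderiv2_eq_const_d2:
  assumes "degree \<sigma> \<le> 2"
  shows "pderiv (pderiv \<sigma>) = [:const_d2 \<sigma>:]"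
proof -
  have "degree (pderiv \<sigma>) \<le> 1"
    using assms by (simp add: degree_pderiv)
  then show ?thesis
    using pderiv_eq_const_d1 by (simp add: const_d1_def const_d2_def)
qed

definition kappa :: "complex poly \<Rightarrow> complex poly \<Rightarrow> complex \<Rightarrow> complex poly" where
  "kappa \<sigma> \<kappa>0 n = smult n (pderiv \<sigma>) + \<kappa>0"

definition omega :: "complex poly \<Rightarrow> complex poly \<Rightarrow> complex \<Rightarrow> complex \<Rightarrow> complex" where
  "omega \<sigma> \<kappa>0 \<omega>0 n = n\<^sup>2 * (const_d2 \<sigma> / 2) + n * const_d1 \<kappa>0 + \<omega>0"

end

theory Submission
  imports Defs
begin

text \<open>
  Write \<open>A = \<sigma>\<partial> + \<kappa>\<^sub>n\<^sub>+\<^sub>1\<close> and let \<open>c\<close> be the constant of the first factorization at \<open>n\<close>. The constant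
  of the second factorization at \<open>n + 1\<close> is the same \<open>c\<close>, so that
  \<open>H\<^sub>n + \<omega>\<^sub>n = A\<partial> + c\<close> and \<open>H\<^sub>n\<^sub>+\<^sub>1 + \<omega>\<^sub>n\<^sub>+\<^sub>1 = \<partial>A + c\<close>. Both transmutation relations are then the
  associativity identities \<open>\<partial>(A\<partial> + c) = (\<partial>A + c)\<partial>\<close> and \<open>A(\<partial>A + c) = (A\<partial> + c)A\<close>, and applying
  them to a solution gives the recurrence relations.
\<close>

text \<open>The body repeats the expression spelled out in the theorem, so the results stated with
  this name take the required form once it is unfolded at the end.\<close>

definition first_order_op :: "complex poly \<Rightarrow> complex poly \<Rightarrow> dop" where
  "first_order_op \<sigma> \<kappa> = mult_op \<sigma> \<circ> deriv \<boxplus> mult_op \<kappa>"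

lemma first_order_op_apply:
  "first_order_op \<sigma> \<kappa> f = (\<lambda>z. poly \<sigma> z * deriv f z + poly \<kappa> z * f z)"
  by (simp add: first_order_op_def add_op_def mult_op_def)

lemma poly_analytic_on: "poly p analytic_on U"
  for p :: "complex poly"
  by (induction p) (auto intro!: analytic_intros)

text \<open>\<open>op_eq_on\<close> gives information only at analytic arguments, so operators can
  be composed only after checking that the inner one yields an analytic function.\<close>

lemma first_order_op_analytic_on:
  assumes "f analytic_on U"
  shows "first_order_op \<sigma> \<kappa> f analytic_on U"
  unfolding first_order_op_apply
  by (intro analytic_intros poly_analytic_on analytic_deriv assms)

text \<open>Operator identities are known only on \<open>U\<close>. Since \<open>U\<close> is a
  neighbourhood of each of its points, they can still be differentiated there.\<close>

lemma deriv_cong_open: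
  assumes "open U" and "z \<in> U" and "\<And>w. w \<in> U \<Longrightarrow> f w = g w"
  shows "deriv f z = deriv g z"
  using assms by (intro deriv_cong_ev refl) (auto simp: eventually_nhds)

lemma deriv_add_scalar_op:
  assumes "f field_differentiable at z" and "g field_differentiable at z"
  shows "deriv (\<lambda>w. g w + c * f w) z = deriv g z + c * deriv f z"
  using assms by (simp add: field_differentiable_mult)

lemma first_order_op_cong_open:
  assumes "open U" and "z \<in> U" and "\<And>w. w \<in> U \<Longrightarrow> f w = g w"
  shows "first_order_op \<sigma> \<kappa> f z = first_order_op \<sigma> \<kappa> g z"
  using deriv_cong_open[OF assms] assms(2,3) by (simp add: first_order_op_apply)

lemma first_order_op_add_scalar_op:
  assumes "f field_differentiable at z" and "g field_differentiable at z"
  shows "first_order_op \<sigma> \<kappa> (\<lambda>w. g w + c * f w) z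
    = first_order_op \<sigma> \<kappa> g z + c * first_order_op \<sigma> \<kappa> f z"
  using deriv_add_scalar_op[OF assms] by (simp add: first_order_op_apply algebra_simps)

text \<open>Analyticity of \<open>A (deriv f)\<close> and of \<open>f\<close> is what lets the outer
  derivative split over the sum. The identity for \<open>L\<close> is used at \<open>f\<close>, the
  one for \<open>M\<close> at \<open>deriv f\<close>.\<close>

lemma op_eq_on_deriv_comp_add_scalar:
  assumes "open U" and "\<And>f. f analytic_on U \<Longrightarrow> A f analytic_on U"
    and "op_eq_on U L (A \<circ> deriv \<boxplus> scalar_op c)" and "op_eq_on U M (deriv \<circ> A \<boxplus> scalar_op c)"
  shows "op_eq_on U (deriv \<circ> L) (M \<circ> deriv)"
  unfolding op_eq_on_def
proof (intro allI impI ballI)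
  fix f z assume f: "f analytic_on U" and z: "z \<in> U"
  have f': "deriv f analytic_on U" using f by (rule analytic_deriv)
  have "deriv (L f) z = deriv (\<lambda>w. A (deriv f) w + c * f w) z"
    using assms(3) f
    by (intro deriv_cong_open[OF assms(1) z]) (simp add: op_eq_on_def add_op_def scalar_op_def)
  also have "\<dots> = deriv (A (deriv f)) z + c * deriv f z"
    using f assms(2)[OF f'] z
    by (intro deriv_add_scalar_op) (auto simp: analytic_on_imp_differentiable_at)
  also have "\<dots> = M (deriv f) z"
    using assms(4) f' z by (simp add: op_eq_on_def add_op_def scalar_op_def)
  finally show "(deriv \<circ> L) f z = (M \<circ> deriv) f z" by simp
qed

text \<open>Now the first-order operator stands outside, so its locality and linearity are used; its
  concrete form supplies both. The identity for \<open>M\<close> is used at \<open>f\<close>, the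
  one for \<open>L\<close> at the analytic function \<open>?A f\<close>.\<close>

lemma op_eq_on_first_order_comp_add_scalar:
  assumes "open U" and "op_eq_on U L (first_order_op \<sigma> \<kappa> \<circ> deriv \<boxplus> scalar_op c)"
    and "op_eq_on U M (deriv \<circ> first_order_op \<sigma> \<kappa> \<boxplus> scalar_op c)"
  shows "op_eq_on U (first_order_op \<sigma> \<kappa> \<circ> M) (L \<circ> first_order_op \<sigma> \<kappa>)"
  unfolding op_eq_on_def
proof (intro allI impI ballI)
  let ?A = "first_order_op \<sigma> \<kappa>"
  fix f z assume f: "f analytic_on U" and z: "z \<in> U"
  have Af: "?A f analytic_on U" using f by (rule first_order_op_analytic_on)
  have "?A (M f) z = ?A (\<lambda>w. deriv (?A f) w + c * f w) z"
    using assms(3) f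
    by (intro first_order_op_cong_open[OF assms(1) z])
      (simp add: op_eq_on_def add_op_def scalar_op_def)
  also have "\<dots> = ?A (deriv (?A f)) z + c * ?A f z"
    using f analytic_deriv[OF Af] z
    by (intro first_order_op_add_scalar_op) (auto simp: analytic_on_imp_differentiable_at)
  also have "\<dots> = L (?A f) z"
    using assms(2) Af z by (simp add: op_eq_on_def add_op_def scalar_op_def)
  finally show "(?A \<circ> M) f z = (L \<circ> ?A) f z" by simp
qed

lemma poly_pderiv_kappa:
  assumes "degree \<sigma> \<le> 2" and "degree \<kappa>0 \<le> 1"
  shows "poly (pderiv (kappa \<sigma> \<kappa>0 n)) z = n * const_d2 \<sigma> + const_d1 \<kappa>0"
  using assms
  by (simp add: kappa_def pderiv_add pderiv_smult pderiv_eq_const_d1 pderiv2_eq_const_d2)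

text \<open>No product rule enters: \<sigma>' + \<kappa>_n = \<kappa>_{n+1} matches the first-order
  terms, and the constant is \<omega>_n + \<kappa>_n'/2 with \<kappa>_n' = n \<sigma>'' +
  \<kappa>_0'.\<close>

lemma op_eq_on_factorization_first_order_deriv:
  assumes "degree \<sigma> \<le> 2" and "degree \<kappa>0 \<le> 1"
  shows "op_eq_on U
    (Hop \<sigma> (kappa \<sigma> \<kappa>0 n) \<boxplus> scalar_op (omega \<sigma> \<kappa>0 \<omega>0 n))
    (first_order_op \<sigma> (kappa \<sigma> \<kappa>0 (n + 1)) \<circ> deriv
      \<boxplus> scalar_op (n * (n + 1) * (const_d2 \<sigma> / 2) + (n + 1/2) * const_d1 \<kappa>0 + \<omega>0))"
  using poly_pderiv_kappa[OF assms]
  \<comment> \<open>\<open>kappa\<close> stays folded in the first pass, where its derivative is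
    evaluated; the second pass unfolds it to compare the indices n and n + 1.\<close>
  by (simp add: op_eq_on_def add_op_def mult_op_def scalar_op_def Hop_def first_order_op_apply
      omega_def field_simps power2_eq_square) (simp add: kappa_def field_simps)

text \<open>By the product rule, \<partial>(\<sigma>\<partial> + \<kappa>_n) = \<sigma>\<partial>^2
  + (\<sigma>' + \<kappa>_n)\<partial> + \<kappa>_n'. Its last term exceeds that of H by
  \<kappa>_n'/2, so the remaining constant is \<omega>_n - \<kappa>_n'/2.\<close>

lemma op_eq_on_factorization_deriv_first_order:
  assumes "degree \<sigma> \<le> 2" and "degree \<kappa>0 \<le> 1" and "open U"
  shows "op_eq_on U
    (Hop \<sigma> (kappa \<sigma> \<kappa>0 n) \<boxplus> scalar_op (omega \<sigma> \<kappa>0 \<omega>0 n))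
    (deriv \<circ> first_order_op \<sigma> (kappa \<sigma> \<kappa>0 n)
      \<boxplus> scalar_op (n * (n - 1) * (const_d2 \<sigma> / 2) + (n - 1/2) * const_d1 \<kappa>0 + \<omega>0))"
  unfolding op_eq_on_def
proof (intro allI impI ballI)
  let ?\<kappa> = "kappa \<sigma> \<kappa>0 n"
  fix f z assume f: "f analytic_on U" and z: "z \<in> U"
  have "(f has_field_derivative deriv f z) (at z)"
    and "(deriv f has_field_derivative deriv (deriv f) z) (at z)"
    using f analytic_deriv[OF f] z
    by (auto simp: DERIV_deriv_iff_field_differentiable analytic_on_imp_differentiable_at)
  then have "(first_order_op \<sigma> ?\<kappa> f has_field_derivative
      poly (pderiv \<sigma>) z * deriv f z + poly \<sigma> z * deriv (deriv f) z
      + poly (pderiv ?\<kappa>) z * f z + poly ?\<kappa> z * deriv f z) (at z)"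
    unfolding first_order_op_apply
    by (auto intro!: derivative_eq_intros poly_DERIV simp: algebra_simps)
  then have "deriv (first_order_op \<sigma> ?\<kappa> f) z =
      poly (pderiv \<sigma>) z * deriv f z + poly \<sigma> z * deriv (deriv f) z
      + poly (pderiv ?\<kappa>) z * f z + poly ?\<kappa> z * deriv f z"
    by (rule DERIV_imp_deriv)
  then show "(Hop \<sigma> ?\<kappa> \<boxplus> scalar_op (omega \<sigma> \<kappa>0 \<omega>0 n)) f z =
    (deriv \<circ> first_order_op \<sigma> ?\<kappa>
      \<boxplus> scalar_op (n * (n - 1) * (const_d2 \<sigma> / 2) + (n - 1/2) * const_d1 \<kappa>0 + \<omega>0)) f z"
    by (simp add: add_op_def mult_op_def scalar_op_def Hop_def poly_pderiv_kappa[OF assms(1,2)]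
        omega_def field_simps power2_eq_square)
qed

theorem theorem3p2:
  fixes \<sigma> \<kappa>0 :: "complex poly" and \<omega>0 n :: complex and U :: "complex set"
  assumes "degree \<sigma> \<le> 2" and "degree \<kappa>0 \<le> 1" and "is_domain U"
  defines "\<kappa> \<equiv> kappa \<sigma> \<kappa>0" and "\<omega> \<equiv> omega \<sigma> \<kappa>0 \<omega>0"
  shows
    "(op_eq_on U
        (Hop \<sigma> (\<kappa> n) \<boxplus> scalar_op (\<omega> n))
        ((mult_op \<sigma> \<circ> deriv \<boxplus> mult_op (\<kappa> (n + 1))) \<circ> deriv
           \<boxplus> scalar_op (n * (n + 1) * (const_d2 \<sigma> / 2) + (n + 1/2) * const_d1 \<kappa>0 + \<omega>0)) \<and>
      op_eq_on U
        ((mult_op \<sigma> \<circ> deriv \<boxplus> mult_op (\<kappa> (n + 1))) \<circ> deriv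
           \<boxplus> scalar_op (n * (n + 1) * (const_d2 \<sigma> / 2) + (n + 1/2) * const_d1 \<kappa>0 + \<omega>0))
        (deriv \<circ> (mult_op \<sigma> \<circ> deriv \<boxplus> mult_op (\<kappa> n))
           \<boxplus> scalar_op (n * (n - 1) * (const_d2 \<sigma> / 2) + (n - 1/2) * const_d1 \<kappa>0 + \<omega>0)))
     \<and>
     (op_eq_on U
        (deriv \<circ> (Hop \<sigma> (\<kappa> n) \<boxplus> scalar_op (\<omega> n)))
        ((Hop \<sigma> (\<kappa> (n + 1)) \<boxplus> scalar_op (\<omega> (n + 1))) \<circ> deriv) \<and>
      op_eq_on U
        ((mult_op \<sigma> \<circ> deriv \<boxplus> mult_op (\<kappa> (n + 1))) \<circ>
           (Hop \<sigma> (\<kappa> (n + 1)) \<boxplus> scalar_op (\<omega> (n + 1))))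
        ((Hop \<sigma> (\<kappa> n) \<boxplus> scalar_op (\<omega> n)) \<circ>
           (mult_op \<sigma> \<circ> deriv \<boxplus> mult_op (\<kappa> (n + 1)))))
     \<and>
     (\<forall>F. F analytic_on U \<longrightarrow>
        ((\<forall>z\<in>U. (Hop \<sigma> (\<kappa> n) \<boxplus> scalar_op (\<omega> n)) F z = 0) \<longrightarrow>
           (\<forall>z\<in>U. (Hop \<sigma> (\<kappa> (n + 1)) \<boxplus> scalar_op (\<omega> (n + 1))) (deriv F) z = 0)) \<and>
        ((\<forall>z\<in>U. (Hop \<sigma> (\<kappa> (n + 1)) \<boxplus> scalar_op (\<omega> (n + 1))) F z = 0) \<longrightarrow>
           (\<forall>z\<in>U. (Hop \<sigma> (\<kappa> n) \<boxplus> scalar_op (\<omega> n))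
              ((mult_op \<sigma> \<circ> deriv \<boxplus> mult_op (\<kappa> (n + 1))) F) z = 0)))"
proof -
  have U: "open U" using assms(3) by (simp add: is_domain_def)
  let ?A = "first_order_op \<sigma> (\<kappa> (n + 1))"
  let ?L = "Hop \<sigma> (\<kappa> n) \<boxplus> scalar_op (\<omega> n)"
  let ?M = "Hop \<sigma> (\<kappa> (n + 1)) \<boxplus> scalar_op (\<omega> (n + 1))"
  let ?c = "n * (n + 1) * (const_d2 \<sigma> / 2) + (n + 1/2) * const_d1 \<kappa>0 + \<omega>0"
  let ?d = "n * (n - 1) * (const_d2 \<sigma> / 2) + (n - 1/2) * const_d1 \<kappa>0 + \<omega>0"
  have fac1: "op_eq_on U ?L (?A \<circ> deriv \<boxplus> scalar_op ?c)"
    unfolding \<kappa>_def \<omega>_def by (rule op_eq_on_factorization_first_order_deriv[OF assms(1,2)])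
  have fac2: "op_eq_on U ?L (deriv \<circ> first_order_op \<sigma> (\<kappa> n) \<boxplus> scalar_op ?d)"
    unfolding \<kappa>_def \<omega>_def by (rule op_eq_on_factorization_deriv_first_order[OF assms(1,2) U])
  have fac12: "op_eq_on U (?A \<circ> deriv \<boxplus> scalar_op ?c)
      (deriv \<circ> first_order_op \<sigma> (\<kappa> n) \<boxplus> scalar_op ?d)"
    using fac1 fac2 by (simp add: op_eq_on_def)
  have "(n + 1) * (n + 1 - 1) * (const_d2 \<sigma> / 2) + (n + 1 - 1/2) * const_d1 \<kappa>0 + \<omega>0 = ?c"
    by (simp add: field_simps)
  then have fac3: "op_eq_on U ?M (deriv \<circ> ?A \<boxplus> scalar_op ?c)"
    using op_eq_on_factorization_deriv_first_order[OF assms(1,2) U, of "n + 1" \<omega>0]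
    unfolding \<kappa>_def \<omega>_def by metis
  have trans1: "op_eq_on U (deriv \<circ> ?L) (?M \<circ> deriv)"
    using U first_order_op_analytic_on fac1 fac3 by (rule op_eq_on_deriv_comp_add_scalar)
  have trans2: "op_eq_on U (?A \<circ> ?M) (?L \<circ> ?A)"
    using U fac1 fac3 by (rule op_eq_on_first_order_comp_add_scalar)
  have rec1: "?M (deriv F) z = 0"
    if "F analytic_on U" "\<forall>z\<in>U. ?L F z = 0" "z \<in> U" for F z
  proof -
    have "?M (deriv F) z = deriv (?L F) z"
      using trans1 that(1,3) by (simp add: op_eq_on_def)
    \<comment> \<open>The equation for \<open>F\<close> holds on all of the open set
      \<open>U\<close>, hence near \<open>z\<close>; its validity at \<open>z\<close> alone would
      not determine the derivative.\<close>
    also have "\<dots> = deriv (\<lambda>_. 0) z"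
      using that(2) by (intro deriv_cong_open[OF U that(3)]) simp
    finally show ?thesis by simp
  qed
  have rec2: "?L (?A F) z = 0"
    if "F analytic_on U" "\<forall>z\<in>U. ?M F z = 0" "z \<in> U" for F z
  proof -
    have "?L (?A F) z = ?A (?M F) z"
      using trans2 that(1,3) by (simp add: op_eq_on_def)
    also have "\<dots> = ?A (\<lambda>_. 0) z"
      using that(2) by (intro first_order_op_cong_open[OF U that(3)]) simp
    finally show ?thesis by (simp add: first_order_op_apply)
  qed
  show ?thesis
    using fac1 fac12 trans1 trans2 rec1 rec2 unfolding first_order_op_def by blast
qed

end
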